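(* Let $\theta_0=(1+\sqrt5)/2$. If $\beta$ is a Perron number of degree $d$ which is neither a Pisot nor a Salem number, then $$\mathrm{Ord}_P(\beta)\le \frac{d\log\theta_0}{\log M(\beta)-\log \beta}=:\mathcal N_p(\beta).$$ In particular, if $\mathcal N_p(\beta)<1$ then $\beta$ is not a Parry number.
   Context: A Perron number is a real algebraic integer $\beta>0$ strictly larger in modulus than all its other Galois conjugates; Pisot numbers (other conjugates in the open unit disc) and Salem numbers (other conjugates in the closed unit disc, at least one on the unit circle) are real algebraic integers $>1$. For real $\beta>1$, $T_\beta(x)=\beta x\bmod1$, and $\beta$ is a Parry number if the orbit $\{T_\beta^k(1)\}_{k\ge1}$ is finite. For an algebraic integer $\beta$ with minimal polynomial $a\prod_{i=1}^d(x-\alpha_i)$, the Mahler measure is $M(\beta)=|a|\prod_{i=1}^d\max\{1,|\alpha_i|\}$. For a Perron number $\beta$, the Parry order is $\mathrm{Ord}_P(\beta)=\max\{n\in\mathbb N:\beta^n \text{ is a Parry number}\}$, with $\mathrm{Ord}_P(\beta)=0$ if no positive power of $\beta$ is Parry, and $\mathrm{Ord}_P(\beta)=\infty$ if $\beta$ is Pisot or Salem. *)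

theory Defs
  imports
    Complex_Main
    "HOL-Library.Extended_Real"
    "HOL-Computational_Algebra.Computational_Algebra"
    "Berlekamp_Zassenhaus.Mahler_Measure"
begin

hide_const (open) module.smult up_ring.coeff

text \<open>
  Minimal polynomials are taken over the integers: irreducible in \<open>\<int>[X]\<close> (hence primitive)
  with positive leading coefficient. For an algebraic integer this is the usual monic minimal
  polynomial over the rationals. The description by \<open>THE\<close> is meaningful only for algebraic
  arguments; see \<open>min_int_poly_algebraic_int\<close> below.
\<close>

definition min_int_poly :: "complex \<Rightarrow> int poly" where
  "min_int_poly x =
     (THE p. irreducible p \<and> lead_coeff p > 0 \<and> poly (map_poly of_int p) x = 0)"

definition alg_degree :: "real \<Rightarrow> nat" where
  "alg_degree \<beta> = degree (min_int_poly (complex_of_real \<beta>))"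

text \<open>The Galois conjugates of \<open>\<beta>\<close> other than \<open>\<beta>\<close> itself.\<close>

definition other_conjugates :: "real \<Rightarrow> complex set" where
  "other_conjugates \<beta> =
     {z. poly (map_poly of_int (min_int_poly (complex_of_real \<beta>))) z = 0} - {complex_of_real \<beta>}"

definition perron_number :: "real \<Rightarrow> bool" where
  "perron_number \<beta> \<longleftrightarrow>
     algebraic_int \<beta> \<and> \<beta> > 0 \<and> (\<forall>z\<in>other_conjugates \<beta>. cmod z < \<bar>\<beta>\<bar>)"

definition pisot_number :: "real \<Rightarrow> bool" where
  "pisot_number \<beta> \<longleftrightarrow>
     algebraic_int \<beta> \<and> \<beta> > 1 \<and> (\<forall>z\<in>other_conjugates \<beta>. cmod z < 1)"

definition salem_number :: "real \<Rightarrow> bool" where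
  "salem_number \<beta> \<longleftrightarrow>
     algebraic_int \<beta> \<and> \<beta> > 1 \<and> (\<forall>z\<in>other_conjugates \<beta>. cmod z \<le> 1) \<and>
     (\<exists>z\<in>other_conjugates \<beta>. cmod z = 1)"

definition beta_map :: "real \<Rightarrow> real \<Rightarrow> real" where
  "beta_map \<beta> x = frac (\<beta> * x)"

definition parry_number :: "real \<Rightarrow> bool" where
  "parry_number \<beta> \<longleftrightarrow> \<beta> > 1 \<and> finite {(beta_map \<beta> ^^ k) 1 | k. k \<ge> 1}"

text \<open>
  The maximum is taken as a supremum in \<^typ>\<open>enat\<close>: it is the maximum when the (nonempty) set of
  exponents is finite, and \<open>\<infinity>\<close>, rather than an unspecified value, when it is infinite.
  The exponent \<open>0\<close> never contributes, since \<open>\<beta> ^ 0 = 1\<close> is not a Parry number.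
\<close>

definition parry_order :: "real \<Rightarrow> enat" where
  "parry_order \<beta> =
     (if pisot_number \<beta> \<or> salem_number \<beta> then \<infinity>
      else if \<not> (\<exists>n\<ge>1. parry_number (\<beta> ^ n)) then 0
      else (SUP n\<in>{n. parry_number (\<beta> ^ n)}. enat n))"

text \<open>The Mahler measure of an algebraic number; \<^const>\<open>mahler_measure\<close> is that of a polynomial.\<close>

definition mahler :: "real \<Rightarrow> real" where
  "mahler \<beta> = mahler_measure (min_int_poly (complex_of_real \<beta>))"

definition \<theta>\<^sub>0 :: real where
  "\<theta>\<^sub>0 = (1 + sqrt 5) / 2"

text \<open>
  Among the Perron numbers that are neither Pisot nor Salem the denominator vanishes only
  for \<open>\<beta> = 1\<close>, where \<open>x / 0 = 0\<close> gives the bound \<open>0\<close>.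
\<close>

definition parry_bound :: "real \<Rightarrow> real" where
  "parry_bound \<beta> = real (alg_degree \<beta>) * ln \<theta>\<^sub>0 / (ln (mahler \<beta>) - ln \<beta>)"


text \<open>Well-definedness of the minimal polynomial of an algebraic integer.\<close>

lemma irreducible_int_poly_root_dvd:
  fixes p q :: "int poly" and x :: complex
  assumes p: "irreducible p" and px: "poly (map_poly of_int p) x = 0"
    and q: "poly (map_poly of_int q) x = 0"
  shows "p dvd q"
proof -
  have prime: "prime_elem p"
    using p by (simp add: irreducible_imp_prime_elem_gcd)
  have p0: "p \<noteq> 0" using p by auto
  have degp: "degree p > 0"
  proof (rule ccontr)
    assume "\<not> degree p > 0"
    then obtain c where "p = [:c:]" by (auto elim: degree_eq_zeroE)
    then show False using px p0 by (simp add: map_poly_pCons)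
  qed
  have not_dvd_const: "\<not> p dvd [:c:]" if "c \<noteq> 0" for c
    using dvd_imp_degree_le[of p "[:c:]"] that degp by auto
  define P where "P = (\<lambda>m::int poly. m \<noteq> 0 \<and> poly (map_poly of_int m) x = 0)"
  define m where "m = (ARG_MIN degree m. P m)"
  have "P p" using p0 px by (simp add: P_def)
  then have m: "P m" and least: "\<And>r. P r \<Longrightarrow> degree m \<le> degree r"
    unfolding m_def by (auto intro: arg_min_natI arg_min_nat_le)
  have m_dvd: "\<exists>c t. c \<noteq> 0 \<and> smult c r = m * t" if r: "poly (map_poly of_int r) x = 0" for r
  proof -
    obtain t s where ts: "pseudo_divmod r m = (t, s)" by (cases "pseudo_divmod r m")
    have m0: "m \<noteq> 0" using m by (simp add: P_def)
    from pseudo_divmod[OF m0 ts]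
    have eq: "smult (lead_coeff m ^ (Suc (degree r) - degree m)) r = m * t + s"
      and s: "s = 0 \<or> degree s < degree m" by auto
    have "poly (map_poly of_int (m * t + s)) x = (0::complex)"
      unfolding eq[symmetric] using r by (simp add: of_int_hom.map_poly_hom_smult)
    then have "poly (map_poly of_int s) x = (0::complex)"
      using m by (simp add: P_def of_int_poly_hom.hom_add of_int_poly_hom.hom_mult)
    then have "s = 0" using s least[of s] unfolding P_def by (meson not_le)
    then have "smult (lead_coeff m ^ (Suc (degree r) - degree m)) r = m * t" using eq by simp
    moreover have "lead_coeff m ^ (Suc (degree r) - degree m) \<noteq> 0" using m0 by simp
    ultimately show ?thesis by blast
  qed
  have "p dvd m"
  proof -
    obtain c t where c: "c \<noteq> 0" and ct: "smult c p = m * t" using m_dvd[OF px] by blast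
    have "p dvd m * t" using ct by (metis dvd_refl dvd_smult)
    then consider "p dvd m" | "p dvd t" using prime_elem_dvd_multD[OF prime] by blast
    then show ?thesis
    proof cases
      case 2
      then obtain u where t: "t = p * u" by (elim dvdE)
      have "p * [:c:] = p * (m * u)" using ct t by (simp add: algebra_simps)
      then have cu: "[:c:] = m * u" using p0 by (metis mult_left_cancel)
      then have "m * u \<noteq> 0" using c by (metis pCons_eq_0_iff)
      moreover have "degree (m * u) = 0" by (simp flip: cu)
      ultimately have "degree m = 0" by (auto simp: degree_mult_eq)
      then obtain d where "m = [:d:]" by (auto elim: degree_eq_zeroE)
      then show ?thesis using m by (auto simp: P_def of_int_hom.map_poly_pCons_hom)
    qed
  qed
  obtain c t where c: "c \<noteq> 0" and ct: "smult c q = m * t" using m_dvd[OF q] by blast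
  have "p dvd [:c:] * q" using \<open>p dvd m\<close> ct by simp
  then show ?thesis using prime_elem_dvd_multD[OF prime] not_dvd_const[OF c] by blast
qed

lemma min_int_poly_algebraic_int:
  fixes x :: complex
  assumes "algebraic_int x"
  shows "irreducible (min_int_poly x)" and "lead_coeff (min_int_poly x) > 0"
    and "poly (map_poly of_int (min_int_poly x)) x = 0"
proof -
  let ?Q = "\<lambda>p::int poly. irreducible p \<and> lead_coeff p > 0 \<and> poly (map_poly of_int p) x = 0"
  have "\<exists>!p. ?Q p"
  proof (rule ex_ex1I)
    from assms obtain g :: "int poly"
      where g: "poly (map_poly of_int g) x = 0" "lead_coeff g = 1"
      unfolding algebraic_int_altdef_ipoly by blast
    have "g \<noteq> 0" using g(2) by auto
    then have "\<exists>p. irreducible p \<and> poly (map_poly of_int p) x = 0"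
      using g(1)
    proof (induction g rule: prime_divisors_induct)
      case zero
      then show ?case by simp
    next
      case (unit u)
      then obtain c where "u = [:c:]" "c \<noteq> 0" by (auto simp: is_unit_poly_iff)
      then show ?case using unit by (simp add: map_poly_pCons)
    next
      case (factor p q)
      then show ?case
        by (auto simp: of_int_poly_hom.hom_mult dest: prime_elem_imp_irreducible)
    qed
    then obtain p where p: "irreducible p" "poly (map_poly of_int p) x = 0" by blast
    show "\<exists>p. ?Q p"
    proof (cases "lead_coeff p > 0")
      case False
      have "lead_coeff p \<noteq> 0" using p(1) by auto
      then have "?Q (- p)" using p False by (auto simp: of_int_poly_hom.hom_uminus)
      then show ?thesis by blast
    qed (use p in blast)
  next
    fix p q assume p: "?Q p" and q: "?Q q"
    have "p dvd q" "q dvd p"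
      using p q irreducible_int_poly_root_dvd by blast+
    then obtain u v where u: "q = p * u" and v: "p = q * v" by (elim dvdE)
    have "p \<noteq> 0" using p by auto
    have "p = p * (u * v)" using v unfolding u by (simp only: mult.assoc)
    then have "u * v = 1" using \<open>p \<noteq> 0\<close> by (metis mult_cancel_left1)
    then have "is_unit u" by (metis dvd_triv_left)
    with u obtain c where c: "u = [:c:]" "is_unit c" by (auto simp: is_unit_poly_iff)
    have "lead_coeff q = lead_coeff p * c" using u c by (simp add: mult.commute)
    then have "c > 0" using p q by (simp add: zero_less_mult_iff)
    then have "c = 1" using c by auto
    then show "p = q" using u c by simp
  qed
  from theI'[OF this] show "irreducible (min_int_poly x)" "lead_coeff (min_int_poly x) > 0"
    "poly (map_poly of_int (min_int_poly x)) x = 0"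
    unfolding min_int_poly_def by auto
qed

end

(*
  Let x_k be the orbit of 1 under T_beta. The power series sum x_k z^k has coefficients in [0,1],
  constant term 1, and (1 - beta z) times it is 1 - sum t_k z^k with t_k the digits of 1. If beta
  is a Parry number, 1/gamma is a zero of the series for every conjugate gamma of modulus > 1 other
  than beta, and zeros of such series have modulus at least 1/theta_0; hence |gamma| <= theta_0
  (Solomyak). Applied to beta^n this gives |z|^n <= theta_0 for every other conjugate z of a Perron
  number beta, and multiplying over the conjugates gives (M(beta)/beta)^n <= theta_0^(d-1).
*)
theory Submission
  imports Defs
begin

section \<open>Zeros of power series with coefficients in [0,1]\<close>

text \<open>On the circle of radius r, 1/(1-z) traces a circle symmetric about the real axis, whose
  leftmost point 1/(1+r) comes from z = -r. Algebraically the claim reduces to (1-r)(r + Re z) >=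
  0.\<close>

lemma Re_inverse_one_minus_ge:
  assumes "cmod z < 1"
  shows "1 / (1 + cmod z) \<le> Re (1 / (1 - z))"
proof -
  define r where "r = cmod z"
  define x where "x = Re z"
  have r: "0 \<le> r" "r < 1" using assms by (auto simp: r_def)
  have x: "- r \<le> x" using abs_Re_le_cmod[of z] by (simp add: r_def x_def)
  have r2: "r\<^sup>2 = x\<^sup>2 + (Im z)\<^sup>2" by (simp add: r_def x_def cmod_power2)
  have eq: "Re (1 / (1 - z)) = (1 - x) / (1 - 2 * x + r\<^sup>2)"
    unfolding Re_divide r2 by (simp add: x_def power2_eq_square algebra_simps)
  have "1 - 2 * x + r\<^sup>2 = (cmod (1 - z))\<^sup>2"
    unfolding r2 cmod_power2 by (simp add: x_def power2_eq_square algebra_simps)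
  moreover have "z \<noteq> 1" using assms by auto
  ultimately have pos: "1 - 2 * x + r\<^sup>2 > 0" by simp
  have "0 \<le> (1 - r) * (r + x)" using r x by simp
  then have "1 - 2 * x + r\<^sup>2 \<le> (1 - x) * (1 + r)"
    by (simp add: algebra_simps power2_eq_square)
  then show ?thesis
    unfolding eq r_def[symmetric] using pos r by (simp add: field_simps)
qed

text \<open>Solomyak's estimate. Centring the coefficients at \<open>1/2\<close> bounds the series by a
  geometric one, which forces \<open>\<bar>1 + 1 / (1 - z)\<bar> \<le> 1 / (1 - \<bar>z\<bar>) - 1\<close>.\<close>
lemma zero_of_unit_interval_series:
  fixes c :: "nat \<Rightarrow> real" and z :: complex
  assumes c0: "c 0 = 1" and c: "\<And>k. 0 \<le> c k" "\<And>k. c k \<le> 1"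
    and z: "cmod z < 1" and zero: "(\<lambda>k. of_real (c k) * z ^ k) sums 0"
  shows "1 \<le> cmod z + (cmod z)\<^sup>2"
proof -
  define r where "r = cmod z"
  have r: "0 \<le> r" "r < 1" using z by (auto simp: r_def)
  \<comment> \<open>Twice the coefficients centred at 1/2, with one more unit removed at k = 0: as
    \<open>c 0 = 1\<close>, this makes \<open>e 0 = 0\<close>, so the geometric majorant starts at k
    = 1.\<close>
  define e where "e = (\<lambda>k. 2 * c k - 1 - (if k = 0 then 1 else 0))"
  have delta: "(\<lambda>k. (if k = 0 then 1 else 0) :: 'a::real_normed_field) sums 1"
    using sums_single[of 0 "\<lambda>_. 1 :: 'a"] by (simp add: eq_commute)
  have "(\<lambda>k. 2 * (of_real (c k) * z ^ k) - z ^ k - (if k = 0 then 1 else 0))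
      sums (2 * 0 - 1 / (1 - z) - 1)"
    by (intro sums_diff sums_mult zero geometric_sums z delta)
  also have "(\<lambda>k. 2 * (of_real (c k) * z ^ k) - z ^ k - (if k = 0 then 1 else 0))
      = (\<lambda>k. of_real (e k) * z ^ k)"
    by (auto simp: e_def algebra_simps)
  also have "2 * 0 - 1 / (1 - z) - 1 = - (1 + 1 / (1 - z))" by simp
  finally have E: "(\<lambda>k. of_real (e k) * z ^ k) sums (- (1 + 1 / (1 - z)))" .
  have G: "(\<lambda>k. r ^ k - (if k = 0 then 1 else 0)) sums (1 / (1 - r) - 1)"
    using r by (intro sums_diff geometric_sums delta) auto
  have "norm (of_real (e k) * z ^ k) \<le> r ^ k - (if k = 0 then 1 else 0)" for k
  proof (cases "k = 0")
    case False
    then have "\<bar>e k\<bar> \<le> 1" using c[of k] by (auto simp: e_def)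
    then show ?thesis using False r
      by (auto simp: norm_mult norm_power r_def intro!: mult_left_le_one_le)
  qed (simp add: e_def c0)
  then have "cmod (\<Sum>k. of_real (e k) * z ^ k) \<le> (\<Sum>k. r ^ k - (if k = 0 then 1 else 0))"
    by (rule norm_suminf_le) (use G in \<open>auto simp: sums_iff\<close>)
  then have "cmod (- (1 + 1 / (1 - z))) \<le> 1 / (1 - r) - 1"
    using E G by (simp only: sums_iff)
  then have "Re (1 + 1 / (1 - z)) \<le> 1 / (1 - r) - 1"
    using complex_Re_le_cmod[of "1 + 1 / (1 - z)"] by (simp only: norm_minus_cancel)
  then have "2 + 1 / (1 + r) \<le> 1 / (1 - r)"
    using Re_inverse_one_minus_ge[OF z] unfolding r_def[symmetric] by simp
  then have "2 * ((1 + r) * (1 - r)) + (1 - r) \<le> 1 + r"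
    using r by (simp add: field_simps)
  then show ?thesis unfolding r_def[symmetric] by (simp add: algebra_simps power2_eq_square)
qed

section \<open>The golden ratio bound for conjugates of a Parry number\<close>

lemma golden_ratio_bound:
  fixes x :: real
  assumes "0 < x" "x\<^sup>2 \<le> x + 1"
  shows "x \<le> \<theta>\<^sub>0"
proof -
  have "(2 * x - 1)\<^sup>2 \<le> 5" using assms by (simp add: power2_eq_square algebra_simps)
  then have "2 * x - 1 \<le> sqrt 5" by (rule real_le_rsqrt)
  then show ?thesis by (simp add: \<theta>\<^sub>0_def)
qed

text \<open>With \<open>x\<close> the orbit of \<open>1\<close> and \<open>y\<close> its formal conjugate, \<open>\<gamma> y\<^sub>k - y\<^sub>k\<^sub>+\<^sub>1\<close> and
  \<open>\<beta> x\<^sub>k - x\<^sub>k\<^sub>+\<^sub>1\<close> are the same digit. Boundedness of \<open>y\<close> makes \<open>1 / \<gamma>\<close> a zero of \<open>\<Sum>\<^sub>k x\<^sub>k z\<^sup>k\<close>.\<close>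
lemma parry_conjugate_bound:
  fixes \<beta> :: real and \<gamma> :: complex
  assumes parry: "parry_number \<beta>" and ne: "\<gamma> \<noteq> of_real \<beta>"
    and conj: "\<And>p :: int poly. poly (map_poly of_int p) (complex_of_real \<beta>) = 0 \<Longrightarrow>
                 poly (map_poly of_int p) \<gamma> = 0"
    and gt1: "cmod \<gamma> > 1"
  shows "cmod \<gamma> \<le> \<theta>\<^sub>0"
proof -
  define x where "x = (\<lambda>k. (beta_map \<beta> ^^ k) 1)"
  define t where "t = (\<lambda>k. \<lfloor>\<beta> * x k\<rfloor>)"
  \<comment> \<open>Each step is X q - \<open>t k\<close>, so \<open>p k\<close> takes the value
    \<open>x k\<close> at \<beta>; its value at \<gamma> will be \<open>y k\<close>.\<close>
  define p :: "nat \<Rightarrow> int poly" where "p = rec_nat 1 (\<lambda>k q. [:- t k, 1:] + [:0, 1:] * (q - 1))"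
  have p0: "p 0 = 1" and pS: "p (Suc k) = [:- t k, 1:] + [:0, 1:] * (p k - 1)" for k
    by (simp_all add: p_def)
  define ev where "ev = (\<lambda>(q :: int poly) (w :: complex). poly (map_poly of_int q) w)"
  have evS: "ev (p (Suc k)) w = w * ev (p k) w - of_int (t k)" for k w
    by (simp add: ev_def pS of_int_poly_hom.hom_add of_int_poly_hom.hom_mult
        of_int_poly_hom.hom_minus of_int_hom.map_poly_pCons_hom algebra_simps)
  have ev0: "ev (p 0) w = 1" for w by (simp add: ev_def p0)
  have x0: "x 0 = 1" and xS: "x (Suc k) = \<beta> * x k - of_int (t k)" for k
    by (simp_all add: x_def t_def beta_map_def frac_def)
  have x_bounds: "0 \<le> x k \<and> x k \<le> 1" for k
    by (cases k) (auto simp: x_def beta_map_def frac_lt_1 less_imp_le)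
  have evx: "ev (p k) (of_real \<beta>) = of_real (x k)" for k
    by (induction k) (simp_all add: ev0 x0 evS xS)
  define y where "y = (\<lambda>k. ev (p k) \<gamma>)"
  \<comment> \<open>A coincidence in the orbit is an integer polynomial vanishing at \<beta>, so it
    transfers to \<gamma>. Hence y takes finitely many values once x does, and is bounded.\<close>
  have y_cong: "y j = y k" if "x j = x k" for j k
  proof -
    have "ev (p j - p k) (of_real \<beta>) = 0"
      using evx[of j] evx[of k] that by (simp add: ev_def of_int_poly_hom.hom_minus)
    then have "ev (p j - p k) \<gamma> = 0" using conj by (simp add: ev_def)
    then show ?thesis by (simp add: y_def ev_def of_int_poly_hom.hom_minus)
  qed
  have "finite (range x)"
  proof -
    have "range x \<subseteq> insert 1 {(beta_map \<beta> ^^ k) 1 |k. k \<ge> 1}"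
    proof
      fix v assume "v \<in> range x"
      then obtain k where "v = x k" by auto
      then show "v \<in> insert 1 {(beta_map \<beta> ^^ k) 1 |k. k \<ge> 1}"
        by (cases k) (force simp: x_def)+
    qed
    then show ?thesis using parry by (auto simp: parry_number_def elim: finite_subset)
  qed
  moreover have "range y \<subseteq> (\<lambda>v. y (SOME k. x k = v)) ` range x"
  proof
    fix v assume "v \<in> range y"
    then obtain k where k: "v = y k" by auto
    have "x (SOME j. x j = x k) = x k" by (rule someI) simp
    then have "v = y (SOME j. x j = x k)" using y_cong k by metis
    then show "v \<in> (\<lambda>v. y (SOME k. x k = v)) ` range x" by blast
  qed
  ultimately have "finite (range y)" by (meson finite_imageI finite_subset)
  then have "cmod (y k) \<le> Max (cmod ` range y)" for k by (intro Max_ge) auto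
  then obtain C where C: "\<And>k. cmod (y k) \<le> C" by blast
  define z where "z = inverse \<gamma>"
  have \<gamma>0: "\<gamma> \<noteq> 0" using gt1 by auto
  have z1: "cmod z < 1" using gt1 by (simp add: z_def norm_inverse inverse_less_1_iff)
  have pow0: "(\<lambda>k. z ^ k) \<longlonglongrightarrow> 0" using z1 by (rule LIMSEQ_power_zero)
  have y0: "(\<lambda>k. y k * z ^ k) \<longlonglongrightarrow> 0"
  proof (rule tendsto_0_le[OF pow0])
    show "\<forall>\<^sub>F k in sequentially. norm (y k * z ^ k) \<le> norm (z ^ k) * C"
      using C by (auto simp: norm_mult mult.commute[of _ C] intro!: always_eventually mult_right_mono)
  qed
  define g where "g = (\<lambda>k. of_real (x k) * z ^ k)"
  have "summable g"
  proof (rule summable_comparison_test')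
    show "summable (\<lambda>k. cmod z ^ k)" using z1 by (intro summable_geometric) simp
    show "norm (g k) \<le> cmod z ^ k" if "k \<ge> 0" for k
      using x_bounds[of k] by (auto simp: g_def norm_mult norm_power intro!: mult_left_le_one_le)
  qed
  then obtain s where s: "g sums s" by (auto simp: summable_def)
  \<comment> \<open>Both sides equal \<open>t k\<close> times \<open>z ^ Suc k\<close>. The left
    telescopes to \<open>y 0\<close>; the right sums to (\<beta>z - 1)s +
    \<open>g 0\<close>.\<close>
  have step: "y k * z ^ k - y (Suc k) * z ^ Suc k = (\<beta> * z) * g k - g (Suc k)" for k
  proof -
    have "\<gamma> * y k - y (Suc k) = of_int (t k)"
      by (simp add: y_def evS)
    moreover have "of_real \<beta> * of_real (x k) - of_real (x (Suc k)) = complex_of_int (t k)"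
      by (simp add: xS)
    ultimately have "(\<gamma> * y k - y (Suc k)) * z ^ Suc k
        = (of_real \<beta> * of_real (x k) - of_real (x (Suc k))) * z ^ Suc k" by simp
    moreover have "\<gamma> * z = 1" using \<gamma>0 by (simp add: z_def)
    then have "\<gamma> * (z * (y k * z ^ k)) = y k * z ^ k" by (simp flip: mult.assoc)
    ultimately show ?thesis by (simp add: g_def algebra_simps)
  qed
  have "(\<lambda>k. y k * z ^ k - y (Suc k) * z ^ Suc k) sums (y 0 * z ^ 0 - 0)"
    by (rule telescope_sums'[OF y0])
  moreover have "(\<lambda>k. g (Suc k)) sums (s - g 0)" using s by (subst sums_Suc_iff) simp
  then have "(\<lambda>k. (\<beta> * z) * g k - g (Suc k)) sums ((\<beta> * z) * s - (s - g 0))"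
    by (intro sums_diff sums_mult s)
  ultimately have "y 0 * z ^ 0 - 0 = (\<beta> * z) * s - (s - g 0)"
    unfolding step by (rule sums_unique2)
  \<comment> \<open>\<open>y 0\<close> and \<open>g 0\<close> are both 1 and cancel; \<gamma>
    \<noteq> \<beta> then rules out \<beta>z = 1.\<close>
  then have "(\<beta> * z - 1) * s = 0" by (simp add: y_def ev0 g_def x0 algebra_simps)
  moreover have "\<beta> * z - 1 \<noteq> 0" using ne \<gamma>0 by (auto simp: z_def field_simps)
  ultimately have "s = 0" by simp
  then have "1 \<le> cmod z + (cmod z)\<^sup>2"
    using s x_bounds z1 x0
    by (intro zero_of_unit_interval_series[of x z]) (auto simp: g_def)
  moreover have "cmod z * cmod \<gamma> = 1" using \<gamma>0 by (simp add: z_def norm_inverse)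
  then have "(cmod z + (cmod z)\<^sup>2) * (cmod \<gamma>)\<^sup>2 = cmod \<gamma> + 1"
    by (simp add: algebra_simps power2_eq_square)
  ultimately have "(cmod \<gamma>)\<^sup>2 \<le> cmod \<gamma> + 1"
    using mult_right_mono[of 1 "cmod z + (cmod z)\<^sup>2" "(cmod \<gamma>)\<^sup>2"] by simp
  then show ?thesis using gt1 by (intro golden_ratio_bound) auto
qed

section \<open>Minimal polynomials and the Mahler measure\<close>

text \<open>The minimal polynomial divides the monic polynomial witnessing integrality, so its
  positive leading coefficient divides 1.\<close>

lemma lead_coeff_min_int_poly:
  fixes x :: complex
  assumes "algebraic_int x"
  shows "lead_coeff (min_int_poly x) = 1"
proof -
  obtain g :: "int poly" where g: "poly (map_poly of_int g) x = 0" "lead_coeff g = 1"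
    using assms unfolding algebraic_int_altdef_ipoly by blast
  have "min_int_poly x dvd g"
    using irreducible_int_poly_root_dvd min_int_poly_algebraic_int[OF assms] g by blast
  then obtain h where "g = min_int_poly x * h" by (elim dvdE)
  then have "lead_coeff (min_int_poly x) * lead_coeff h = 1"
    using g by (simp add: lead_coeff_mult)
  then show ?thesis
    using min_int_poly_algebraic_int(2)[OF assms] by (auto simp: zmult_eq_1_iff)
qed

lemma min_int_poly_simple_root:
  fixes x :: complex
  assumes "algebraic_int x"
  shows "poly (pderiv (map_poly of_int (min_int_poly x))) x \<noteq> 0"
proof
  let ?p = "min_int_poly x"
  note p = min_int_poly_algebraic_int[OF assms]
  assume "poly (pderiv (map_poly of_int ?p)) x = 0"
  then have "poly (map_poly of_int (pderiv ?p)) x = 0"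
    by (simp add: of_int_hom.map_poly_pderiv)
  then have "?p dvd pderiv ?p" using irreducible_int_poly_root_dvd p by blast
  moreover have "degree ?p \<noteq> 0"
  proof
    assume "degree ?p = 0"
    then obtain a where "?p = [:a:]" by (auto elim: degree_eq_zeroE)
    then show False using p by (auto simp: map_poly_pCons)
  qed
  ultimately show False using not_dvd_pderiv by blast
qed

text \<open>The minimal polynomial is separable at \<open>\<beta>\<close>, so \<open>\<beta>\<close> contributes exactly one factor.\<close>
lemma mahler_eq:
  assumes "algebraic_int \<beta>" "\<beta> \<ge> 1"
  obtains rs where "set rs = other_conjugates \<beta>" "Suc (length rs) = alg_degree \<beta>"
    "mahler \<beta> = \<beta> * (\<Prod>a\<leftarrow>rs. max 1 (cmod a))"
proof -
  let ?b = "complex_of_real \<beta>"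
  have alg: "algebraic_int ?b" using assms(1) by simp
  define P where "P = map_poly complex_of_int (min_int_poly ?b)"
  define as where "as = complex_roots_complex P"
  have lc: "lead_coeff P = 1" using lead_coeff_min_int_poly[OF alg] by (simp add: P_def)
  have dec: "P = (\<Prod>a\<leftarrow>as. [:- a, 1:])"
    using complex_roots(1)[of P] by (simp add: as_def lc)
  have len: "length as = alg_degree \<beta>" by (simp add: as_def P_def alg_degree_def)
  have root_iff: "poly P z = 0 \<longleftrightarrow> z \<in> set as" for z
    unfolding dec by (induction as) auto
  have "?b \<in> set as" using min_int_poly_algebraic_int(3)[OF alg] root_iff by (simp add: P_def)
  then obtain us vs where as: "as = us @ ?b # vs" by (meson split_list)
  define rs where "rs = us @ vs"
  have P: "P = [:- ?b, 1:] * (\<Prod>a\<leftarrow>rs. [:- a, 1:])"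
    unfolding dec as rs_def by (simp only: map_append list.map prod_list.append prod_list.Cons mult_ac)
  \<comment> \<open>The derivative of (X - \<beta>)Q at \<beta> is Q(\<beta>), so simplicity of the
    root keeps \<beta> out of \<open>rs\<close>.\<close>
  have "poly (pderiv P) ?b = poly (\<Prod>a\<leftarrow>rs. [:- a, 1:]) ?b"
    unfolding P pderiv_mult by (simp add: pderiv_pCons)
  then have "poly (\<Prod>a\<leftarrow>rs. [:- a, 1:]) ?b \<noteq> 0"
    using min_int_poly_simple_root[OF alg] by (simp add: P_def)
  then have "?b \<notin> set rs" by (induction rs) auto
  then have "set rs = other_conjugates \<beta>"
    using root_iff unfolding other_conjugates_def P_def[symmetric] by (auto simp: as rs_def)
  moreover have "mahler \<beta> = \<beta> * (\<Prod>a\<leftarrow>rs. max 1 (cmod a))"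
    unfolding mahler_def mahler_measure_def mahler_measure_poly_def P_def[symmetric] as_def[symmetric]
    using assms(2) by (simp add: lc as rs_def mult_ac)
  moreover have "Suc (length rs) = alg_degree \<beta>" using len by (simp add: as rs_def)
  ultimately show ?thesis using that by blast
qed

section \<open>Powers of a Perron number and the bound on the Parry order\<close>

text \<open>If q vanishes at \<beta>^n, then q(X^n) vanishes at \<beta>, hence at z, so q vanishes
  at z^n. Strict dominance of \<beta> keeps z^n and \<beta>^n apart, so the bound for conjugates of
  a Parry number applies when |z|^n > 1.\<close>

lemma conjugate_power_bound:
  assumes per: "perron_number \<beta>" and parry: "parry_number (\<beta> ^ n)"
    and z: "z \<in> other_conjugates \<beta>"
  shows "cmod z ^ n \<le> \<theta>\<^sub>0"
proof (cases "cmod z ^ n > 1")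
  case True
  have alg: "algebraic_int (complex_of_real \<beta>)" using per by (simp add: perron_number_def)
  have n: "n \<noteq> 0" using True by (cases n) auto
  have "cmod z < \<beta>" using per z by (auto simp: perron_number_def)
  then have "cmod (z ^ n) < \<beta> ^ n" using n by (simp add: norm_power power_strict_mono)
  moreover have "cmod (complex_of_real (\<beta> ^ n)) = \<beta> ^ n"
    using per by (simp add: perron_number_def norm_power)
  ultimately have "z ^ n \<noteq> of_real (\<beta> ^ n)" by auto
  moreover have "poly (map_poly of_int q) (z ^ n) = 0"
    if q: "poly (map_poly of_int q) (complex_of_real (\<beta> ^ n)) = 0" for q
  proof -
    have ev: "poly (map_poly of_int (pcompose q (Polynomial.monom 1 n))) w = poly (map_poly of_int q) (w ^ n)"
      for w :: complex
      by (simp add: of_int_hom.map_poly_pcompose poly_pcompose map_poly_monom poly_monom)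
    have "min_int_poly (of_real \<beta>) dvd pcompose q (Polynomial.monom 1 n)"
      using irreducible_int_poly_root_dvd min_int_poly_algebraic_int[OF alg] q ev[of "of_real \<beta>"]
      by simp
    then have "poly (map_poly of_int (pcompose q (Polynomial.monom 1 n))) z = 0"
      using z by (auto simp: other_conjugates_def of_int_poly_hom.hom_mult elim!: dvdE)
    then show ?thesis using ev by simp
  qed
  ultimately have "cmod (z ^ n) \<le> \<theta>\<^sub>0"
    using parry True by (intro parry_conjugate_bound) (auto simp: norm_power)
  then show ?thesis by (simp add: norm_power)
next
  case False
  have "1 \<le> sqrt 5" by simp
  then have "1 \<le> \<theta>\<^sub>0" unfolding \<theta>\<^sub>0_def by simp
  then show ?thesis using False by simp
qed

lemma prod_list_max_one_ge_1: "1 \<le> (\<Prod>a\<leftarrow>as. max 1 (cmod a))"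
proof (induction as)
  case (Cons a as)
  then show ?case using mult_mono[of 1 "max 1 (cmod a)" 1] by simp
qed simp

lemma parry_power_le_bound:
  assumes per: "perron_number \<beta>" and "\<not> pisot_number \<beta>" "\<not> salem_number \<beta>"
    and parry: "parry_number (\<beta> ^ n)"
  shows "real n \<le> parry_bound \<beta>"
proof -
  have alg: "algebraic_int \<beta>" and "\<beta> > 0" using per by (auto simp: perron_number_def)
  have "\<beta> ^ n > 1" using parry by (simp add: parry_number_def)
  then have b1: "\<beta> > 1" using \<open>\<beta> > 0\<close> power_le_one[of \<beta> n] by (meson less_imp_le not_le)
  obtain rs where rs: "set rs = other_conjugates \<beta>" "Suc (length rs) = alg_degree \<beta>"
    "mahler \<beta> = \<beta> * (\<Prod>a\<leftarrow>rs. max 1 (cmod a))"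
    using mahler_eq[OF alg] b1 by (metis less_imp_le)
  let ?R = "\<Prod>a\<leftarrow>rs. max 1 (cmod a)"
  \<comment> \<open>As \<beta> > 1 is neither Pisot nor Salem, some other conjugate lies outside the
    closed unit disc. This makes the denominator \<open>ln ?R\<close> positive.\<close>
  obtain w where w: "w \<in> set rs" "cmod w > 1"
    using assms(2,3) alg b1 rs(1) by (force simp: pisot_number_def salem_number_def)
  obtain us vs where uv: "rs = us @ w # vs" using w by (meson split_list)
  have "1 < cmod w * (\<Prod>a\<leftarrow>us @ vs. max 1 (cmod a))"
    using w(2) prod_list_max_one_ge_1[of "us @ vs"]
    by (meson less_le_trans mult_le_cancel_left1 norm_ge_zero order_less_le_trans not_le)
  then have R1: "?R > 1" using w by (simp add: uv mult_ac max_def)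
  have th1: "\<theta>\<^sub>0 > 1" by (simp add: \<theta>\<^sub>0_def)
  \<comment> \<open>Each conjugate costs one factor \<open>\<theta>\<^sub>0\<close>; arbitrary lists
    of conjugates allow the induction.\<close>
  have "(\<Prod>a\<leftarrow>as. max 1 (cmod a)) ^ n \<le> \<theta>\<^sub>0 ^ length as" if "set as \<subseteq> other_conjugates \<beta>" for as
    using that
  proof (induction as)
    case (Cons a as)
    have "max 1 (cmod a) ^ n \<le> \<theta>\<^sub>0"
      using conjugate_power_bound[OF per parry, of a] Cons.prems th1 by (auto simp: max_def)
    then have "max 1 (cmod a) ^ n * (\<Prod>a\<leftarrow>as. max 1 (cmod a)) ^ n \<le> \<theta>\<^sub>0 * \<theta>\<^sub>0 ^ length as"
      using Cons th1 prod_list_max_one_ge_1[of as] by (intro mult_mono) auto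
    then show ?case by (simp add: power_mult_distrib)
  qed simp
  then have "?R ^ n \<le> \<theta>\<^sub>0 ^ length rs" using rs by simp
  then have "ln (?R ^ n) \<le> ln (\<theta>\<^sub>0 ^ length rs)" using R1 th1 by (subst ln_le_cancel_iff) auto
  then have "real n * ln ?R \<le> real (length rs) * ln \<theta>\<^sub>0"
    using R1 th1 by (simp add: ln_realpow)
  \<comment> \<open>\<open>rs\<close> omits \<beta> and has d - 1 entries; here d - 1 is relaxed to
    d.\<close>
  also have "\<dots> \<le> real (alg_degree \<beta>) * ln \<theta>\<^sub>0"
    using rs(2) th1 by (intro mult_right_mono) auto
  finally have "real n * ln ?R \<le> real (alg_degree \<beta>) * ln \<theta>\<^sub>0" .
  moreover have "ln (mahler \<beta>) - ln \<beta> = ln ?R"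
    unfolding rs(3) using b1 R1 by (simp add: ln_mult_pos)
  ultimately show ?thesis
    unfolding parry_bound_def using R1 by (simp add: pos_le_divide_eq)
qed

text \<open>Settles the case of order 0. For \<beta> \<ge> 1 the Mahler measure is \<beta> times
  factors at least 1; for \<beta> < 1, \<open>ln \<beta>\<close> is negative while the measure is at
  least 1.\<close>

lemma parry_bound_nonneg:
  assumes "perron_number \<beta>"
  shows "0 \<le> parry_bound \<beta>"
proof -
  have alg: "algebraic_int \<beta>" and b0: "\<beta> > 0" using assms by (auto simp: perron_number_def)
  have "ln \<theta>\<^sub>0 \<ge> 0" by (simp add: \<theta>\<^sub>0_def)
  moreover have "ln \<beta> \<le> ln (mahler \<beta>)"
  proof (cases "\<beta> \<ge> 1")
    case True
    obtain rs where rs: "mahler \<beta> = \<beta> * (\<Prod>a\<leftarrow>rs. max 1 (cmod a))"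
      using mahler_eq[OF alg True] by metis
    show ?thesis using b0 prod_list_max_one_ge_1[of rs] by (simp add: rs)
  next
    case False
    have "min_int_poly (complex_of_real \<beta>) \<noteq> 0"
      using alg min_int_poly_algebraic_int(1)[of "complex_of_real \<beta>"] by auto
    then have "mahler \<beta> \<ge> 1" unfolding mahler_def by (rule mahler_measure_poly_ge_1)
    then show ?thesis using False b0 by simp
  qed
  ultimately show ?thesis by (simp add: parry_bound_def)
qed

theorem theorem2p2:
  fixes \<beta> :: real
  assumes "perron_number \<beta>"
    and "\<not> pisot_number \<beta>"
    and "\<not> salem_number \<beta>"
  shows "ereal_of_enat (parry_order \<beta>) \<le> ereal (parry_bound \<beta>)
    \<and> (parry_bound \<beta> < 1 \<longrightarrow> \<not> parry_number \<beta>)"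
proof
  note le = parry_power_le_bound[OF assms]
  show "ereal_of_enat (parry_order \<beta>) \<le> ereal (parry_bound \<beta>)"
  proof (cases "\<exists>n\<ge>1. parry_number (\<beta> ^ n)")
    case True
    let ?N = "{n. parry_number (\<beta> ^ n)}"
    have "parry_order \<beta> = (SUP n\<in>?N. enat n)" using True assms by (simp add: parry_order_def)
    \<comment> \<open>Nonemptiness of \<open>?N\<close> matters: the empty supremum is 0 in
      \<open>enat\<close> but -\<infinity> in \<open>ereal\<close>.\<close>
    moreover have "ereal_of_enat (SUP n\<in>?N. enat n) = (SUP n\<in>?N. ereal n)"
      using True by (subst ereal_of_enat_Sup) (auto simp: image_comp)
    ultimately show ?thesis using le by (auto intro!: SUP_least)
  next
    case False
    then show ?thesis
      using assms parry_bound_nonneg[OF assms(1)] by (simp add: parry_order_def)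
  qed
  show "parry_bound \<beta> < 1 \<longrightarrow> \<not> parry_number \<beta>"
    using le[of 1] by auto
qed

end
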